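(* Let $n>1$ and $d>1$ be integers. Then there exist $\lambda_{d,n}>0$ and a packing $\widehat{\mathcal{P}}^n=\{\widehat{\mathbf{c}}_i+\mathbf{B}^d : 1\le i\le n\}$ of $n$ unit balls in $\mathbb{E}^d$ possessing the largest contact number among all packings of $n$ unit balls in $\mathbb{E}^d$, such that for all $\lambda$ with $0<\lambda<\lambda_{d,n}$ the quantity $\delta_d(n,\lambda)$ is generated by $\widehat{\mathcal{P}}^n$, i.e., $$\mathrm{vol}_d\Big(\bigcup_{i=1}^n(\mathbf{c}_i+(1+\lambda)\mathbf{B}^d)\Big)\ \ge\ \mathrm{vol}_d\Big(\bigcup_{i=1}^n(\widehat{\mathbf{c}}_i+(1+\lambda)\mathbf{B}^d)\Big)$$ holds for every packing $\mathcal{P}^n=\{\mathbf{c}_i+\mathbf{B}^d : 1\le i\le n\}$ of $n$ unit balls in $\mathbb{E}^d$.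
   Context: $\mathbb{E}^d$ is $d$-dimensional Euclidean space, $\mathbf{B}^d$ its closed unit ball centered at the origin, $\mathrm{vol}_d$ the $d$-dimensional volume, $\omega_d=\mathrm{vol}_d(\mathbf{B}^d)$. A packing of $n$ unit balls in $\mathbb{E}^d$ is a family $\{\mathbf{c}_i+\mathbf{B}^d: 1\le i\le n\}$ with $\|\mathbf{c}_j-\mathbf{c}_k\|\ge 2$ for all $1\le j<k\le n$. Its contact number is the number of touching pairs of balls, i.e. the number of pairs $j<k$ with $\|\mathbf{c}_j-\mathbf{c}_k\|=2$. For $\lambda>0$, $$\delta_d(n,\lambda):=\max_{\mathcal{P}^n}\frac{n\omega_d}{\mathrm{vol}_d\left(\bigcup_{i=1}^n(\mathbf{c}_i+(1+\lambda)\mathbf{B}^d)\right)},$$ the maximum being over all packings $\mathcal{P}^n$ of $n$ unit balls in $\mathbb{E}^d$. *)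

theory Defs
  imports "HOL-Analysis.Analysis"
begin

text \<open>
  The space \<open>\<bbbE>\<^sup>d\<close> is a type of class \<^class>\<open>euclidean_space\<close> with \<open>d = DIM('a)\<close>. A family of
  \<open>n\<close> unit balls is given by its centres \<open>c 1, \<dots>, c n\<close>; the values of \<open>c\<close> at other indices are
  irrelevant to all the notions below.
\<close>

definition unit_ball_packing :: "nat \<Rightarrow> (nat \<Rightarrow> 'a::euclidean_space) \<Rightarrow> bool" where
  "unit_ball_packing n c \<longleftrightarrow> (\<forall>j k. 1 \<le> j \<and> j < k \<and> k \<le> n \<longrightarrow> norm (c j - c k) \<ge> 2)"

definition contact_number :: "nat \<Rightarrow> (nat \<Rightarrow> 'a::euclidean_space) \<Rightarrow> nat" where
  "contact_number n c = card {(j, k). 1 \<le> j \<and> j < k \<and> k \<le> n \<and> norm (c j - c k) = 2}"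

definition thickened_volume :: "nat \<Rightarrow> real \<Rightarrow> (nat \<Rightarrow> 'a::euclidean_space) \<Rightarrow> real" where
  "thickened_volume n l c = measure lebesgue (\<Union>i\<in>{1..n}. cball (c i) (1 + l))"

text \<open>
  \<open>packing_delta TYPE('a) n l\<close> is \<open>\<delta>\<^sub>d(n, l)\<close> for \<open>d = DIM('a)\<close>. The maximum over all packings is
  written as a supremum, since \<^const>\<open>Max\<close> is only meaningful for finite sets; the two agree whenever
  the maximum is attained.
\<close>

definition packing_delta :: "'a::euclidean_space itself \<Rightarrow> nat \<Rightarrow> real \<Rightarrow> real" where
  "packing_delta _ n l =
     (SUP c \<in> {c :: nat \<Rightarrow> 'a. unit_ball_packing n c}.
        real n * measure lebesgue (cball (0 :: 'a) 1) / thickened_volume n l c)"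

end

theory Submission
  imports Defs
begin

text \<open>
  For \<open>l \<le> 1/10\<close> no three of the enlarged balls have a common point, so the volume of their union is
  that of \<open>n\<close> disjoint balls minus the volumes of the pairwise lenses. A lens is largest when its two
  balls touch, and it vanishes once the distance of the centres exceeds \<open>2 + 2l\<close>. By compactness, for
  small \<open>l\<close> the number of pairs at distance at most \<open>2 + 2l\<close> is at most the maximal contact number in
  every packing. Hence any packing with the maximal contact number maximises the total lens volume.
\<close>

section \<open>Orthogonal transformations and Lebesgue measure\<close>

text \<open>
  Uniqueness of Haar measure: integrating \<open>1\<^sub>A (T x) 1\<^sub>U (T x + y)\<close> over \<open>x\<close> and \<open>y\<close> in both orders
  compares \<open>T -` A\<close> with \<open>A\<close>, normalised by the \<open>T\<close>-invariant unit ball \<open>U\<close>.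
\<close>

lemma emeasure_lborel_vimage_orthogonal:
  fixes T :: "'a::euclidean_space \<Rightarrow> 'a"
  assumes T: "orthogonal_transformation T" and A: "A \<in> sets borel"
  shows "emeasure lborel (T -` A) = emeasure lborel A"
proof -
  have lin: "linear T" and norm_T: "\<And>v. norm (T v) = norm v"
    using T by (auto simp: orthogonal_transformation)
  have surj: "surj T"
    using T by (rule orthogonal_transformation_surj)
  have [measurable]: "T \<in> borel_measurable borel"
    using lin by (intro borel_measurable_continuous_onI linear_continuous_on linear_linear[THEN iffD2])
  note [measurable] = A
  define U where "U = cball (0::'a) 1"
  have [measurable]: "U \<in> sets borel" by (simp add: U_def)
  have TU: "T -` U = U" by (auto simp: U_def norm_T)
  have preim: "(\<integral>\<^sup>+x. indicator C (T x) \<partial>lborel) = emeasure lborel (T -` C)" if [measurable]: "C \<in> sets borel" for C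
  proof -
    have "(\<integral>\<^sup>+x. indicator C (T x) \<partial>lborel) = (\<integral>\<^sup>+x. indicator (T -` C) x \<partial>lborel)"
      by (intro nn_integral_cong) (auto split: split_indicator)
    also have "\<dots> = emeasure lborel (T -` C)"
      using measurable_sets[of T borel borel C] by (intro nn_integral_indicator) auto
    finally show ?thesis .
  qed
  have shift: "(\<integral>\<^sup>+y. indicator C (z + y) \<partial>lborel) = emeasure lborel C"
    if [measurable]: "C \<in> sets borel" for C and z :: 'a
  proof -
    have "emeasure lborel C = emeasure (distr lborel borel ((+) z)) C"
      by (simp add: lborel_distr_plus)
    also have "\<dots> = (\<integral>\<^sup>+y. indicator C y \<partial>distr lborel borel ((+) z))"
      by simp
    also have "\<dots> = (\<integral>\<^sup>+y. indicator C (z + y) \<partial>lborel)"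
      by (subst nn_integral_distr) auto
    finally show ?thesis by simp
  qed
  have reflect: "(\<integral>\<^sup>+y. indicator C (z - y) \<partial>lborel) = emeasure lborel C"
    if [measurable]: "C \<in> sets borel" for C and z :: 'a
  proof -
    \<comment> \<open>The affine map has scaling factor -1, so its Jacobian has absolute value 1 and
      the density disappears.\<close>
    have D: "lborel = distr lborel borel (\<lambda>x. z + (-1) *\<^sub>R x)"
      by (subst lborel_affine[of "-1" z]) (auto simp: density_1)
    have "emeasure lborel C = (\<integral>\<^sup>+y. indicator C y \<partial>distr lborel borel (\<lambda>x. z + (-1) *\<^sub>R x))"
      by (subst D) simp
    also have "\<dots> = (\<integral>\<^sup>+y. indicator C (z - y) \<partial>lborel)"
      by (subst nn_integral_distr) auto
    finally show ?thesis by simp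
  qed
  have "emeasure lborel (T -` A) * emeasure lborel U
      = (\<integral>\<^sup>+x. indicator A (T x) * (\<integral>\<^sup>+y. indicator U (T x + y) \<partial>lborel) \<partial>lborel)"
    by (simp add: shift nn_integral_multc preim)
  also have "\<dots> = (\<integral>\<^sup>+x. (\<integral>\<^sup>+y. indicator A (T x) * indicator U (T x + y) \<partial>lborel) \<partial>lborel)"
    by (intro nn_integral_cong nn_integral_cmult[symmetric]) measurable
  also have "\<dots> = (\<integral>\<^sup>+y. (\<integral>\<^sup>+x. indicator A (T x) * indicator U (T x + y) \<partial>lborel) \<partial>lborel)"
    by (rule lborel_pair.Fubini'[symmetric]) measurable
  also have "\<dots> = (\<integral>\<^sup>+y. (\<integral>\<^sup>+x. indicator A (T x - y) * indicator U (T x) \<partial>lborel) \<partial>lborel)"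
  proof (rule nn_integral_cong)
    fix y :: 'a
    \<comment> \<open>Translating \<open>x\<close> by \<open>- w\<close> moves \<open>y\<close> from
      the argument of \<open>U\<close> to that of \<open>A\<close>. After the next exchange of
      integrals, \<open>y\<close> occurs only in \<open>A\<close>, where it integrates out.\<close>
    obtain w where w: "T w = y" using surj by (metis surjD)
    have "(\<integral>\<^sup>+x. indicator A (T x) * indicator U (T x + y) \<partial>lborel)
      = (\<integral>\<^sup>+x. indicator A (T x) * indicator U (T x + y) \<partial>distr lborel borel ((+) (- w)))"
      by (simp add: lborel_distr_plus)
    also have "\<dots> = (\<integral>\<^sup>+x. indicator A (T (- w + x)) * indicator U (T (- w + x) + y) \<partial>lborel)"
      by (subst nn_integral_distr) auto
    also have "\<dots> = (\<integral>\<^sup>+x. indicator A (T x - y) * indicator U (T x) \<partial>lborel)"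
      by (intro nn_integral_cong) (simp add: linear_diff[OF lin] w)
    finally show "(\<integral>\<^sup>+x. indicator A (T x) * indicator U (T x + y) \<partial>lborel)
      = (\<integral>\<^sup>+x. indicator A (T x - y) * indicator U (T x) \<partial>lborel)" .
  qed
  also have "\<dots> = (\<integral>\<^sup>+x. (\<integral>\<^sup>+y. indicator A (T x - y) * indicator U (T x) \<partial>lborel) \<partial>lborel)"
    by (rule lborel_pair.Fubini') measurable
  also have "\<dots> = (\<integral>\<^sup>+x. (\<integral>\<^sup>+y. indicator A (T x - y) \<partial>lborel) * indicator U (T x) \<partial>lborel)"
    by (intro nn_integral_cong nn_integral_multc) measurable
  also have "\<dots> = emeasure lborel A * emeasure lborel U"
    by (simp add: reflect nn_integral_cmult preim TU)
  finally have "emeasure lborel (T -` A) * emeasure lborel U = emeasure lborel A * emeasure lborel U" .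
  moreover have "emeasure lborel U \<noteq> 0" "emeasure lborel U \<noteq> top"
  proof -
    have "unit_ball_vol (real DIM('a)) \<noteq> 0"
      using unit_ball_vol_pos[of "real DIM('a)"] by linarith
    then show "emeasure lborel U \<noteq> 0" "emeasure lborel U \<noteq> top"
      by (auto simp: U_def emeasure_cball)
  qed
  ultimately show ?thesis
    using ennreal_mult_cancel_left[of "emeasure lborel U" "emeasure lborel (T -` A)" "emeasure lborel A"]
    by (simp add: mult.commute)
qed

text \<open>Together with the invariance of the measure, this makes the volume of a lens depend only
  on the distance between its centres.\<close>

lemma orthogonal_transformation_mapping:
  fixes u v :: "'a::euclidean_space"
  assumes "norm u = norm v"
  obtains T where "orthogonal_transformation T" "T u = v"
proof (cases "u = v")
  case True
  then show thesis using that[of "\<lambda>x. x"] by simp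
next
  case False
  define w where "w = u - v"
  have w: "w \<bullet> w \<noteq> 0" using False by (simp add: w_def)
  have uv: "u \<bullet> u = v \<bullet> v" using assms by (simp add: norm_eq)
  then have uw: "2 * (w \<bullet> u) = w \<bullet> w"
    by (simp add: w_def inner_diff inner_commute)
  \<comment> \<open>the reflection in the hyperplane orthogonal to \<open>u - v\<close>\<close>
  define T where "T x = x - (2 * (w \<bullet> x) / (w \<bullet> w)) *\<^sub>R w" for x
  have "linear T"
    by (rule linearI) (simp_all add: T_def inner_add_right algebra_simps add_divide_distrib)
  moreover have "T x \<bullet> T y = x \<bullet> y" for x y
    using w by (simp add: T_def inner_diff inner_commute field_simps)
  \<comment> \<open>By \<open>uw\<close> the coefficient of \<open>w\<close> in \<open>T u\<close>
    is 1, so \<open>T u = u - w = v\<close>.\<close>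
  moreover have "T u = v"
    using w uw by (simp add: T_def w_def)
  ultimately show thesis
    by (intro that[of T]) (simp_all add: orthogonal_transformation_def)
qed

section \<open>Lenses of two equal balls\<close>

text \<open>
  By convexity, a ball centred on the segment from \<open>a\<close> to \<open>b\<close> contains the lens of the balls
  centred at \<open>a\<close> and \<open>b\<close>, so sliding the centres towards each other enlarges the lens.
\<close>

lemma measure_lens_le:
  fixes a b a' b' :: "'a::euclidean_space"
  assumes "dist a' b' \<le> dist a b"
  shows "measure lebesgue (cball a r \<inter> cball b r) \<le> measure lebesgue (cball a' r \<inter> cball b' r)"
proof -
  define f where "f u v = measure lebesgue (cball u r \<inter> cball v r)" for u v :: 'a
  have trans: "f u v = f 0 (v - u)" for u v
  proof -
    have "cball u r \<inter> cball v r = (+) u ` (cball 0 r \<inter> cball (v - u) r)"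
      by (simp add: translation_Int flip: cball_translation)
    then show ?thesis by (simp only: f_def measure_translation)
  qed
  have iso: "f 0 u = f 0 v" if eq: "norm u = norm v" for u v
  proof -
    obtain T where T: "orthogonal_transformation T" "T u = v"
      using orthogonal_transformation_mapping[OF eq] by blast
    have "dist x u = dist (T x) v" for x
      using T by (auto simp: orthogonal_transformation_isometry)
    moreover have "norm (T x) = norm x" for x
      using T by (auto simp: orthogonal_transformation)
    ultimately have "T -` (cball 0 r \<inter> cball v r) = cball 0 r \<inter> cball u r"
      by (auto simp: dist_commute)
    then have "emeasure lborel (cball 0 r \<inter> cball u r) = emeasure lborel (cball 0 r \<inter> cball v r)"
      using emeasure_lborel_vimage_orthogonal[OF T(1), of "cball 0 r \<inter> cball v r"] by simp
    then show ?thesis by (simp add: f_def measure_def)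
  qed
  have mono: "f 0 u \<le> f 0 (t *\<^sub>R u)" if "0 \<le> t" "t \<le> 1" for t u
  proof -
    \<comment> \<open>With this \<open>s\<close> the points \<open>s u\<close> and
      \<open>(t + s) u = (1 - s) u\<close> lie on the segment from 0 to \<open>u\<close>,
      symmetrically about its midpoint, and differ by \<open>t u\<close>.\<close>
    define s where "s = (1 - t) / 2"
    have s: "0 \<le> s" "s \<le> 1" "t + s = 1 - s" using that by (auto simp: s_def field_simps)
    have 1: "cball 0 r \<inter> cball u r \<subseteq> cball (p *\<^sub>R u) r" if "0 \<le> p" "p \<le> 1" for p
    proof
      fix x assume "x \<in> cball 0 r \<inter> cball u r"
      \<comment> \<open>Exchange centre and point: the ball around \<open>x\<close> contains 0 and
        \<open>u\<close>, hence every point between them.\<close>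
      then have "0 \<in> cball x r" "u \<in> cball x r" by (auto simp: dist_commute)
      then have "(1 - p) *\<^sub>R 0 + p *\<^sub>R u \<in> cball x r"
        using that by (intro convexD_alt[OF convex_cball]) auto
      then show "x \<in> cball (p *\<^sub>R u) r" by (auto simp: dist_commute)
    qed
    have "f 0 u \<le> f (s *\<^sub>R u) ((t + s) *\<^sub>R u)"
      unfolding f_def using s 1[of s] 1[of "t + s"] that
      by (intro measure_mono_fmeasurable fmeasurable.Int) auto
    also have "\<dots> = f 0 (t *\<^sub>R u)"
      by (subst trans) (simp add: algebra_simps)
    finally show ?thesis .
  qed
  have "f a b \<le> f a' b'"
  proof (cases "a = b")
    case True
    then show ?thesis using assms trans[of a b] trans[of a' b'] by simp
  next
    case False
    define t where "t = dist a' b' / dist a b"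
    have t: "0 \<le> t" "t \<le> 1" "norm (t *\<^sub>R (b - a)) = norm (b' - a')"
      using False assms by (auto simp: t_def dist_norm norm_minus_commute)
    have "f a b \<le> f 0 (t *\<^sub>R (b - a))"
      using mono[OF t(1,2), of "b - a"] by (simp add: trans[of a b])
    also have "\<dots> = f a' b'"
      using iso[OF t(3)] by (simp add: trans[of a' b'])
    finally show ?thesis .
  qed
  then show ?thesis by (simp add: f_def)
qed

section \<open>Volume of a union without triple overlaps\<close>

text \<open>Seen from a common point, the squared distances to the centres sum to at most
  \<open>3 r^2\<close>. Three times this sum bounds the sum of the squared pairwise distances, which
  is at least 12. The threshold 4/3 is the squared circumradius of the equilateral triangle of side
  2.\<close>

lemma not_three_cballs:
  fixes a b c :: "'a::real_inner"
  assumes "dist a b \<ge> 2" "dist a c \<ge> 2" "dist b c \<ge> 2" and r: "r\<^sup>2 < 4/3"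
  shows "cball a r \<inter> cball b r \<inter> cball c r = {}"
proof (rule ccontr)
  assume "cball a r \<inter> cball b r \<inter> cball c r \<noteq> {}"
  then obtain x where x: "dist a x \<le> r" "dist b x \<le> r" "dist c x \<le> r" by auto
  define p q s where "p = a - x" "q = b - x" "s = c - x"
  have small: "v \<bullet> v \<le> r\<^sup>2" if "norm v \<le> r" for v :: 'a
    using power_mono[OF that, of 2] by (simp add: power2_norm_eq_inner)
  have large: "v \<bullet> v \<ge> 4" if "norm v \<ge> 2" for v :: 'a
    using power_mono[OF that, of 2] by (simp add: power2_norm_eq_inner)
  have "p \<bullet> p \<le> r\<^sup>2" "q \<bullet> q \<le> r\<^sup>2" "s \<bullet> s \<le> r\<^sup>2"
    using x by (auto simp: p_q_s_def dist_norm intro: small)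
  moreover have "(p - q) \<bullet> (p - q) \<ge> 4" "(p - s) \<bullet> (p - s) \<ge> 4" "(q - s) \<bullet> (q - s) \<ge> 4"
    using assms by (auto simp: p_q_s_def dist_norm intro: large)
  moreover have "0 \<le> (p + q + s) \<bullet> (p + q + s)" by simp
  moreover have "3 * (p \<bullet> p + q \<bullet> q + s \<bullet> s) - (p + q + s) \<bullet> (p + q + s)
     = (p - q) \<bullet> (p - q) + (p - s) \<bullet> (p - s) + (q - s) \<bullet> (q - s)"
    by (simp add: inner_diff inner_add inner_commute algebra_simps)
  ultimately have "12 \<le> 9 * r\<^sup>2" by argo
  then show False using r by simp
qed

text \<open>Inclusion-exclusion stops after the pairwise terms. In the induction step the new set
  meets the earlier ones in pairwise disjoint pieces, because there are no triple
  intersections.\<close>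

lemma measure_UN_at_most_two:
  fixes B :: "nat \<Rightarrow> 'a set"
  assumes "\<And>i. i \<in> {1..n} \<Longrightarrow> B i \<in> fmeasurable M"
    and "\<And>i j k. \<lbrakk>1 \<le> i; i < j; j < k; k \<le> n\<rbrakk> \<Longrightarrow> B i \<inter> B j \<inter> B k = {}"
  shows "measure M (\<Union>i\<in>{1..n}. B i)
    = (\<Sum>i\<in>{1..n}. measure M (B i)) - (\<Sum>(j, k)\<in>{(j, k). 1 \<le> j \<and> j < k \<and> k \<le> n}. measure M (B j \<inter> B k))"
  using assms
proof (induction n)
  case 0
  have "{(j, k). 1 \<le> j \<and> j < k \<and> k \<le> (0::nat)} = {}" by auto
  then show ?case by (simp only:) simp
next
  case (Suc n)
  let ?P = "\<lambda>n::nat. {(j, k). 1 \<le> j \<and> j < k \<and> k \<le> n}"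
  let ?f = "\<lambda>(j, k). measure M (B j \<inter> B k)"
  have IH: "measure M (\<Union>i\<in>{1..n}. B i) = (\<Sum>i\<in>{1..n}. measure M (B i)) - sum ?f (?P n)"
    using Suc by simp
  have fin: "finite (?P n)"
    by (rule finite_subset[of _ "{1..n} \<times> {1..n}"]) auto
  have split: "?P (Suc n) = ?P n \<union> (\<lambda>j. (j, Suc n)) ` {1..n}" by (auto simp: le_Suc_eq)
  have "sum ?f (?P (Suc n)) = sum ?f (?P n) + sum ?f ((\<lambda>j. (j, Suc n)) ` {1..n})"
    unfolding split by (rule sum.union_disjoint) (use fin in auto)
  also have "sum ?f ((\<lambda>j. (j, Suc n)) ` {1..n}) = (\<Sum>j\<in>{1..n}. measure M (B j \<inter> B (Suc n)))"
    by (subst sum.reindex) (auto simp: inj_on_def)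
  finally have pairs: "sum ?f (?P (Suc n)) = sum ?f (?P n) + (\<Sum>j\<in>{1..n}. measure M (B j \<inter> B (Suc n)))" .
  have "measure M ((\<Union>i\<in>{1..n}. B i) \<inter> B (Suc n)) = measure M (\<Union>i\<in>{1..n}. B i \<inter> B (Suc n))"
    by (rule arg_cong[of _ _ "measure M"]) auto
  also have "\<dots> = (\<Sum>j\<in>{1..n}. measure M (B j \<inter> B (Suc n)))"
  proof (rule measure_UNION')
    show "pairwise (\<lambda>i j. disjnt (B i \<inter> B (Suc n)) (B j \<inter> B (Suc n))) {1..n}"
    proof (rule pairwiseI)
      fix i j assume "i \<in> {1..n}" "j \<in> {1..n}" "i \<noteq> j"
      then show "disjnt (B i \<inter> B (Suc n)) (B j \<inter> B (Suc n))"
        using Suc.prems(2)[of i j "Suc n"] Suc.prems(2)[of j i "Suc n"]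
        by (cases "i < j") (auto simp: disjnt_def)
    qed
  qed (use Suc.prems(1) in \<open>auto intro!: fmeasurable_Int_fmeasurable fmeasurableD\<close>)
  finally have inter: "measure M ((\<Union>i\<in>{1..n}. B i) \<inter> B (Suc n)) = (\<Sum>j\<in>{1..n}. measure M (B j \<inter> B (Suc n)))" .
  have "measure M (\<Union>i\<in>{1..Suc n}. B i) = measure M ((\<Union>i\<in>{1..n}. B i) \<union> B (Suc n))"
    by (simp add: atLeastAtMostSuc_conv Un_commute)
  also have "\<dots> = measure M (\<Union>i\<in>{1..n}. B i) + measure M (B (Suc n)) - measure M ((\<Union>i\<in>{1..n}. B i) \<inter> B (Suc n))"
    using Suc.prems(1) by (intro measure_Un3 fmeasurable.finite_UN) auto
  finally show ?case
    by (simp add: IH inter pairs del: One_nat_def)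
qed

lemma finite_index_pairs: "finite {(j, k). 1 \<le> j \<and> j < k \<and> k \<le> (n::nat) \<and> P j k}"
  by (rule finite_subset[of _ "{1..n} \<times> {1..n}"]) auto

lemma unit_ball_packing_dist:
  assumes "unit_ball_packing n c" "i \<in> {1..n}" "j \<in> {1..n}" "i \<noteq> j"
  shows "2 \<le> dist (c i) (c j)"
proof (cases "i < j")
  case True
  then show ?thesis using assms by (auto simp: unit_ball_packing_def dist_norm)
next
  case False
  then have "2 \<le> norm (c j - c i)" using assms by (auto simp: unit_ball_packing_def)
  then show ?thesis by (simp add: dist_norm norm_minus_commute)
qed

lemma thickened_volume_eq:
  fixes c :: "nat \<Rightarrow> 'a::euclidean_space"
  assumes c: "unit_ball_packing n c" and l: "0 < l" "l \<le> 1/10"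
  shows "thickened_volume n l c = real n * measure lebesgue (cball (0::'a) (1 + l))
    - (\<Sum>(j, k)\<in>{(j, k). 1 \<le> j \<and> j < k \<and> k \<le> n}. measure lebesgue (cball (c j) (1 + l) \<inter> cball (c k) (1 + l)))"
proof -
  \<comment> \<open>The bound 1/10 on \<open>l\<close> is a convenient choice: 1.21 is below the
    threshold 4/3 for triple overlaps.\<close>
  have "(1 + l)\<^sup>2 \<le> (11/10)\<^sup>2" using l by (intro power_mono) auto
  then have r: "(1 + l)\<^sup>2 < 4/3" by (simp add: power2_eq_square)
  have "measure lebesgue (cball (c i) (1 + l)) = measure lebesgue (cball (0::'a) (1 + l))" for i
    using measure_translation[of "c i" "cball 0 (1 + l)"] by (simp flip: cball_translation)
  moreover have "thickened_volume n l c = (\<Sum>i\<in>{1..n}. measure lebesgue (cball (c i) (1 + l)))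
    - (\<Sum>(j, k)\<in>{(j, k). 1 \<le> j \<and> j < k \<and> k \<le> n}. measure lebesgue (cball (c j) (1 + l) \<inter> cball (c k) (1 + l)))"
    unfolding thickened_volume_def
  proof (rule measure_UN_at_most_two)
    fix i j k assume "1 \<le> i" "i < j" "j < k" "k \<le> n"
    then show "cball (c i) (1 + l) \<inter> cball (c j) (1 + l) \<inter> cball (c k) (1 + l) = {}"
      using r by (intro not_three_cballs unit_ball_packing_dist[OF c]) auto
  qed auto
  ultimately show ?thesis by simp
qed

section \<open>Compactness of packings and almost contacts\<close>

text \<open>
  The components of the graph of distances at most 3 have bounded diameter, so each of them can be
  translated rigidly to its own place on a line. This supplies the compactness that a sequence of
  packings drifting apart lacks.
\<close>

lemma bounded_packing_same_short_distances:
  obtains R where "\<And>c :: nat \<Rightarrow> 'a::euclidean_space. unit_ball_packing n c \<Longrightarrow>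
    \<exists>c' :: nat \<Rightarrow> 'a. unit_ball_packing n c' \<and> (\<forall>i\<in>{1..n}. norm (c' i) \<le> R) \<and>
      (\<forall>i\<in>{1..n}. \<forall>j\<in>{1..n}. dist (c i) (c j) \<le> 3 \<longrightarrow> dist (c' i) (c' j) = dist (c i) (c j))"
proof
  \<comment> \<open>\<open>D\<close> bounds the diameter of a component: a path needs at most
    \<open>card E\<close> edges, hence at most \<open>n * n\<close>, each of length at most 3.
    Anchors \<open>M\<close> apart, with every point within \<open>D\<close> of its anchor, leave a
    distance of at least 2 between components.\<close>
  define D M where "D = 3 * real (n * n)" and "M = 2 * D + 2"
  fix c :: "nat \<Rightarrow> 'a" assume c: "unit_ball_packing n c"
  obtain e :: 'a where e: "norm e = 1" using vector_choose_size[of 1] by auto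
  define E where "E = {(i, j). i \<in> {1..n} \<and> j \<in> {1..n} \<and> dist (c i) (c j) \<le> 3}"
  have E: "E \<subseteq> {1..n} \<times> {1..n}" by (auto simp: E_def)
  then have finE: "finite E" by (rule finite_subset) simp
  have cardE: "card E \<le> n * n" using card_mono[OF _ E] by (simp add: card_cartesian_product)
  have "sym E" by (auto simp: E_def sym_def dist_commute)
  then have symE: "(j, i) \<in> E\<^sup>*" if "(i, j) \<in> E\<^sup>*" for i j
    using that by (meson sym_rtrancl symD)
  have pow: "dist (c i) (c j) \<le> 3 * real m" if "(i, j) \<in> E ^^ m" for i j m
    using that
  proof (induction m arbitrary: j)
    case (Suc m)
    then obtain k where "(i, k) \<in> E ^^ m" "(k, j) \<in> E" by auto
    then show ?case
      using Suc.IH[of k] dist_triangle[of "c i" "c j" "c k"] by (auto simp: E_def)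
  qed simp
  have conn: "dist (c i) (c j) \<le> D" if ij: "(i, j) \<in> E\<^sup>*" for i j
  proof -
    obtain m where "m \<le> card E" "(i, j) \<in> E ^^ m"
      using ij finE by (auto simp: rtrancl_finite_eq_relpow)
    then have "dist (c i) (c j) \<le> 3 * real m" "m \<le> n * n" using pow cardE by auto
    moreover from this(2) have "real m \<le> real (n * n)" by (rule of_nat_mono)
    ultimately show ?thesis by (simp add: D_def)
  qed
  \<comment> \<open>The least index labels the component. Being at most \<open>i\<close>, it also
    keeps the translated anchors bounded.\<close>
  define rep where "rep i = (LEAST j. (i, j) \<in> E\<^sup>*)" for i
  have rep: "(i, rep i) \<in> E\<^sup>*" for i
    unfolding rep_def by (rule LeastI[of _ i]) simp
  have rep_le: "rep i \<le> i" for i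
    unfolding rep_def by (rule Least_le) simp
  have rep_eq: "rep i = rep j" if "(i, j) \<in> E" for i j
  proof -
    have "(i, j) \<in> E\<^sup>*" "(j, i) \<in> E\<^sup>*" using that symE by auto
    then have "(i, k) \<in> E\<^sup>* \<longleftrightarrow> (j, k) \<in> E\<^sup>*" for k by (meson rtrancl_trans)
    then show ?thesis by (simp add: rep_def)
  qed
  define c' where "c' i = (c i - c (rep i)) + (real (rep i) * M) *\<^sub>R e" for i
  have M: "0 \<le> D" "0 \<le> M" by (auto simp: D_def M_def)
  have off: "norm (c i - c (rep i)) \<le> D" for i
    using conn[OF rep[of i]] by (simp add: dist_norm)
  have near: "dist (c' i) (c' j) = dist (c i) (c j)" if "rep i = rep j" for i j
    using that by (simp add: c'_def dist_norm)
  have far: "2 \<le> dist (c' i) (c' j)" if "rep i \<noteq> rep j" for i j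
  proof -
    have "1 \<le> \<bar>real (rep i) - real (rep j)\<bar>" using that by linarith
    then have "M \<le> \<bar>real (rep i) - real (rep j)\<bar> * M" using M mult_right_mono by fastforce
    also have "\<dots> = norm ((real (rep i) * M) *\<^sub>R e - (real (rep j) * M) *\<^sub>R e)"
      using e M by (simp add: abs_mult flip: scaleR_left_diff_distrib left_diff_distrib)
    also have "\<dots> = norm (c' i - c' j - (c i - c (rep i)) + (c j - c (rep j)))"
      by (rule arg_cong[of _ _ norm]) (simp add: c'_def)
    also have "\<dots> \<le> norm (c' i - c' j) + norm (c i - c (rep i)) + norm (c j - c (rep j))"
      by norm
    finally show ?thesis using off[of i] off[of j] by (simp add: M_def dist_norm)
  qed
  have "unit_ball_packing n c'"
    unfolding unit_ball_packing_def
  proof (intro allI impI)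
    fix j k assume "1 \<le> j \<and> j < k \<and> k \<le> n"
    then have "2 \<le> dist (c j) (c k)" by (intro unit_ball_packing_dist[OF c]) auto
    then show "2 \<le> norm (c' j - c' k)"
      using near[of j k] far[of j k] by (cases "rep j = rep k") (auto simp: dist_norm)
  qed
  moreover have "norm (c' i) \<le> D + real n * M" if "i \<in> {1..n}" for i
  proof -
    have "norm (c' i) \<le> norm (c i - c (rep i)) + norm ((real (rep i) * M) *\<^sub>R e)"
      unfolding c'_def by (rule norm_triangle_ineq)
    also have "\<dots> \<le> D + real (rep i) * M" using off[of i] e M by simp
    also have "real (rep i) * M \<le> real n * M"
      using that rep_le[of i] M by (intro mult_right_mono) auto
    finally show ?thesis by simp
  qed
  moreover have "dist (c' i) (c' j) = dist (c i) (c j)"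
    if "i \<in> {1..n}" "j \<in> {1..n}" "dist (c i) (c j) \<le> 3" for i j
    using that by (intro near rep_eq) (simp add: E_def)
  ultimately show "\<exists>c' :: nat \<Rightarrow> 'a. unit_ball_packing n c' \<and> (\<forall>i\<in>{1..n}. norm (c' i) \<le> D + real n * M) \<and>
      (\<forall>i\<in>{1..n}. \<forall>j\<in>{1..n}. dist (c i) (c j) \<le> 3 \<longrightarrow> dist (c' i) (c' j) = dist (c i) (c j))"
    by (intro exI[of _ c'] conjI ballI impI)
qed

text \<open>Bolzano-Weierstrass for one index at a time, each step refining the subsequence found
  before.\<close>

lemma finitely_many_bounded_subsequences:
  fixes X :: "nat \<Rightarrow> 'i \<Rightarrow> 'a::heine_borel"
  assumes "finite I" and "\<And>i. i \<in> I \<Longrightarrow> bounded (range (\<lambda>m. X m i))"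
  shows "\<exists>r y. strict_mono (r :: nat \<Rightarrow> nat) \<and> (\<forall>i\<in>I. (\<lambda>m. X (r m) i) \<longlonglongrightarrow> y i)"
  using assms
proof (induction I rule: finite_induct)
  case empty
  show ?case by (intro exI[of _ id]) (auto simp: strict_mono_def)
next
  case (insert i I)
  then obtain r y where r: "strict_mono r" "\<And>j. j \<in> I \<Longrightarrow> (\<lambda>m. X (r m) j) \<longlonglongrightarrow> y j" by blast
  have "bounded (range (\<lambda>m. X (r m) i))"
    using insert.prems[of i] by (rule bounded_subset) auto
  then obtain z s where s: "strict_mono s" "((\<lambda>m. X (r m) i) \<circ> s) \<longlonglongrightarrow> z"
    using bounded_imp_convergent_subsequence by blast
  have "(\<lambda>m. X ((r \<circ> s) m) j) \<longlonglongrightarrow> (y(i := z)) j" if "j \<in> insert i I" for j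
  proof (cases "j = i")
    case True
    then show ?thesis using s(2) by (simp add: o_def)
  next
    case False
    then show ?thesis
      using that LIMSEQ_subseq_LIMSEQ[OF r(2) s(1), of j] by (simp add: o_def)
  qed
  moreover have "strict_mono (r \<circ> s)" using r(1) s(1) by (rule strict_mono_o)
  ultimately show ?case by blast
qed

text \<open>Otherwise there are packings with more than \<open>N\<close> pairs within
  \<open>2 + 1/(m+1)\<close> for every \<open>m\<close>. Once made bounded without changing short
  distances, they subconverge to a packing \<open>y\<close>. Pairs that do not touch in
  \<open>y\<close> eventually leave the count, so \<open>y\<close> has more than \<open>N\<close>
  contacts.\<close>

lemma card_almost_contacts_le:
  assumes max: "\<And>c :: nat \<Rightarrow> 'a::euclidean_space. unit_ball_packing n c \<Longrightarrow> contact_number n c \<le> N"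
  obtains \<epsilon> :: real where "0 < \<epsilon>"
    "\<And>c :: nat \<Rightarrow> 'a. unit_ball_packing n c \<Longrightarrow>
      card {(j, k). 1 \<le> j \<and> j < k \<and> k \<le> n \<and> dist (c j) (c k) \<le> 2 + \<epsilon>} \<le> N"
proof (rule ccontr)
  define S :: "(nat \<Rightarrow> 'a) \<Rightarrow> real \<Rightarrow> (nat \<times> nat) set"
    where "S c d = {(j, k). 1 \<le> j \<and> j < k \<and> k \<le> n \<and> dist (c j) (c k) \<le> d}" for c d
  note witness = that
  assume "\<not> thesis"
  have "\<exists>c. unit_ball_packing n c \<and> N < card (S c (2 + \<epsilon>))" if \<epsilon>: "0 < \<epsilon>" for \<epsilon>
  proof (rule ccontr)
    assume "\<nexists>c. unit_ball_packing n c \<and> N < card (S c (2 + \<epsilon>))"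
    then have "card (S c (2 + \<epsilon>)) \<le> N" if "unit_ball_packing n c" for c
      using that not_less by blast
    then have thesis by (intro witness[OF \<epsilon>]) (simp add: S_def)
    with \<open>\<not> thesis\<close> show False ..
  qed
  then have "\<exists>c. unit_ball_packing n c \<and> N < card (S c (2 + inverse (real (Suc m))))" for m
    by simp
  then obtain x where
    x: "unit_ball_packing n (x m)" "N < card (S (x m) (2 + inverse (real (Suc m))))" for m
    by metis
  have finS: "finite (S c d)" for c d
    unfolding S_def by (rule finite_index_pairs)
  obtain R where R: "\<And>c :: nat \<Rightarrow> 'a. unit_ball_packing n c \<Longrightarrow>
    \<exists>c' :: nat \<Rightarrow> 'a. unit_ball_packing n c' \<and> (\<forall>i\<in>{1..n}. norm (c' i) \<le> R) \<and>
      (\<forall>i\<in>{1..n}. \<forall>j\<in>{1..n}. dist (c i) (c j) \<le> 3 \<longrightarrow> dist (c' i) (c' j) = dist (c i) (c j))"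
    using bounded_packing_same_short_distances[of n] by blast
  have "\<exists>X :: nat \<Rightarrow> nat \<Rightarrow> 'a. \<forall>m. unit_ball_packing n (X m) \<and> (\<forall>i\<in>{1..n}. norm (X m i) \<le> R) \<and>
    (\<forall>i\<in>{1..n}. \<forall>j\<in>{1..n}. dist (x m i) (x m j) \<le> 3 \<longrightarrow> dist (X m i) (X m j) = dist (x m i) (x m j))"
    by (intro choice allI R x(1))
  then obtain X :: "nat \<Rightarrow> nat \<Rightarrow> 'a" where X: "unit_ball_packing n (X m)" "\<And>i. i \<in> {1..n} \<Longrightarrow> norm (X m i) \<le> R"
    "\<And>i j. \<lbrakk>i \<in> {1..n}; j \<in> {1..n}; dist (x m i) (x m j) \<le> 3\<rbrakk> \<Longrightarrow> dist (X m i) (X m j) = dist (x m i) (x m j)"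
    for m by blast
  have card_X: "N < card (S (X m) (2 + inverse (real (Suc m))))" for m
  proof -
    \<comment> \<open>Thus all counted distances are at most 3, the range in which
      \<open>X m\<close> reproduces the distances of \<open>x m\<close>.\<close>
    have "inverse (real (Suc m)) \<le> 1" by (simp add: inverse_le_1_iff)
    then have "S (x m) (2 + inverse (real (Suc m))) \<subseteq> S (X m) (2 + inverse (real (Suc m)))"
      using X(3)[of _ _ m] by (auto simp: S_def)
    then show ?thesis
      using x(2)[of m] card_mono[OF finS] by (meson order_less_le_trans)
  qed
  have "bounded (range (\<lambda>m. X m i))" if "i \<in> {1..n}" for i
    using X(2)[OF that] by (auto simp: bounded_iff)
  then obtain r y where r: "strict_mono (r :: nat \<Rightarrow> nat)" and y: "\<And>i. i \<in> {1..n} \<Longrightarrow> (\<lambda>m. X (r m) i) \<longlonglongrightarrow> y i"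
    using finitely_many_bounded_subsequences[of "{1..n}" X] by blast
  have lim: "(\<lambda>m. dist (X (r m) j) (X (r m) k)) \<longlonglongrightarrow> dist (y j) (y k)" if "1 \<le> j" "j < k" "k \<le> n" for j k
    using that by (intro tendsto_dist y) auto
  have y2: "2 \<le> dist (y j) (y k)" if "1 \<le> j" "j < k" "k \<le> n" for j k
    using lim[OF that] by (rule LIMSEQ_le_const) (use that in \<open>auto intro!: exI[of _ 0] unit_ball_packing_dist X(1)\<close>)
  then have "unit_ball_packing n y" by (auto simp: unit_ball_packing_def dist_norm)
  then have "contact_number n y \<le> N" by (rule max)
  let ?Q = "{(j, k). 1 \<le> j \<and> j < k \<and> k \<le> n \<and> dist (y j) (y k) \<noteq> 2}"
  have to2: "(\<lambda>m. 2 + inverse (real (Suc (r m)))) \<longlonglongrightarrow> 2"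
    using LIMSEQ_subseq_LIMSEQ[OF LIMSEQ_inverse_real_of_nat_add[of 2] r] by (simp add: o_def)
  \<comment> \<open>There are finitely many non-touching pairs, so one \<open>m\<close> serves all
    of them. For each pair, a number \<open>u\<close> strictly between 2 and the limit distance
    eventually separates the tolerance from the distance.\<close>
  have "\<forall>\<^sub>F m in sequentially. \<forall>p\<in>?Q. p \<notin> S (X (r m)) (2 + inverse (real (Suc (r m))))"
  proof (rule eventually_ball_finite[OF finite_index_pairs], rule ballI)
    fix p assume "p \<in> ?Q"
    then obtain j k where p: "p = (j, k)" and jk: "1 \<le> j" "j < k" "k \<le> n" "dist (y j) (y k) \<noteq> 2" by auto
    then have "2 < dist (y j) (y k)" using y2[OF jk(1-3)] by simp
    then obtain u where u: "2 < u" "u < dist (y j) (y k)" using dense by blast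
    have "\<forall>\<^sub>F m in sequentially. u < dist (X (r m) j) (X (r m) k)"
      using lim[OF jk(1-3)] u(2) by (rule order_tendstoD)
    moreover have "\<forall>\<^sub>F m in sequentially. 2 + inverse (real (Suc (r m))) < u"
      using to2 u(1) by (rule order_tendstoD)
    ultimately show "\<forall>\<^sub>F m in sequentially. p \<notin> S (X (r m)) (2 + inverse (real (Suc (r m))))"
      by eventually_elim (auto simp: p S_def)
  qed
  then obtain m where m: "\<And>p. p \<in> ?Q \<Longrightarrow> p \<notin> S (X (r m)) (2 + inverse (real (Suc (r m))))"
    using eventually_happens'[OF sequentially_bot] by blast
  have "S (X (r m)) (2 + inverse (real (Suc (r m)))) \<subseteq> {(j, k). 1 \<le> j \<and> j < k \<and> k \<le> n \<and> norm (y j - y k) = 2}"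
    using m by (auto simp: dist_norm S_def)
  then have "card (S (X (r m)) (2 + inverse (real (Suc (r m))))) \<le> contact_number n y"
    unfolding contact_number_def by (rule card_mono[OF finite_index_pairs])
  then show False using card_X[of "r m"] \<open>contact_number n y \<le> N\<close> by simp
qed

section \<open>Extremal packings and comparison of lens sums\<close>

text \<open>Any bound uniform in \<open>c\<close> suffices to make the largest contact number
  attained.\<close>

lemma contact_number_le: "contact_number n c \<le> n * n"
proof -
  have "contact_number n c \<le> card ({1..n} \<times> {1..n})"
    unfolding contact_number_def by (rule card_mono) auto
  then show ?thesis by (simp add: card_cartesian_product)
qed

lemma unit_ball_packing_exists: "\<exists>c :: nat \<Rightarrow> 'a::euclidean_space. unit_ball_packing n c"
proof -
  obtain e :: 'a where e: "norm e = 2" using vector_choose_size[of 2] by auto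
  have "2 \<le> norm (real j *\<^sub>R e - real k *\<^sub>R e)" if "j < k" for j k :: nat
    using that e by (simp flip: scaleR_left_diff_distrib)
  then show ?thesis by (auto simp: unit_ball_packing_def intro!: exI[of _ "\<lambda>j. real j *\<^sub>R e"])
qed

lemma thickened_volume_pos:
  fixes c :: "nat \<Rightarrow> 'a::euclidean_space"
  assumes "1 \<le> n" "0 < l"
  shows "0 < thickened_volume n l c"
proof -
  have "0 < measure lebesgue (cball (c 1) (1 + l))"
    using assms content_cball_pos[of "1 + l" "c 1"] by simp
  also have "\<dots> \<le> thickened_volume n l c"
    unfolding thickened_volume_def using assms
    by (intro measure_mono_fmeasurable fmeasurable.finite_UN) auto
  finally show ?thesis .
qed

text \<open>Lenses of centres more than \<open>2 * r\<close> apart are empty, and each of the others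
  is at most the lens of two touching unit balls enlarged to radius \<open>r\<close>, represented by
  \<open>u\<close> and \<open>v\<close>.\<close>

lemma sum_lenses_le:
  fixes c :: "nat \<Rightarrow> 'a::euclidean_space"
  assumes c: "unit_ball_packing n c" and uv: "dist u v = 2"
    and N: "card {(j, k). 1 \<le> j \<and> j < k \<and> k \<le> n \<and> dist (c j) (c k) \<le> 2 * r} \<le> N"
  shows "(\<Sum>(j, k)\<in>{(j, k). 1 \<le> j \<and> j < k \<and> k \<le> n}. measure lebesgue (cball (c j) r \<inter> cball (c k) r))
    \<le> real N * measure lebesgue (cball u r \<inter> cball (v :: 'a) r)" (is "sum ?f ?P \<le> real N * ?L")
proof -
  let ?S = "{(j, k). 1 \<le> j \<and> j < k \<and> k \<le> n \<and> dist (c j) (c k) \<le> 2 * r}"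
  have "sum ?f ?P = sum ?f ?S"
  proof (rule sum.mono_neutral_right)
    show "finite ?P" using finite_index_pairs[of n "\<lambda>_ _. True"] by simp
    show "\<forall>p\<in>?P - ?S. ?f p = 0"
    proof
      fix p assume "p \<in> ?P - ?S"
      then obtain j k where p: "p = (j, k)" "2 * r < dist (c j) (c k)" by (auto simp flip: not_le)
      have "\<not> (dist (c j) z \<le> r \<and> dist (c k) z \<le> r)" for z
        using p(2) dist_triangle2[of "c j" "c k" z] by linarith
      then have "cball (c j) r \<inter> cball (c k) r = {}" by auto
      then show "?f p = 0" by (simp add: p)
    qed
  qed auto
  also have "\<dots> \<le> real (card ?S) * ?L"
  proof (rule sum_bounded_above)
    fix p assume "p \<in> ?S"
    then obtain j k where p: "p = (j, k)" "1 \<le> j" "j < k" "k \<le> n" by auto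
    have dist: "2 \<le> dist (c j) (c k)" using p by (intro unit_ball_packing_dist[OF c]) auto
    then show "?f p \<le> ?L" unfolding p(1) prod.case using uv by (intro measure_lens_le) simp
  qed
  also have "\<dots> \<le> real N * ?L" using N by (intro mult_right_mono) auto
  finally show ?thesis .
qed

text \<open>The matching lower bound: every contact contributes a full reference lens, and the other
  pairs contribute nonnegative amounts.\<close>

lemma contact_number_lenses_le_sum:
  fixes c :: "nat \<Rightarrow> 'a::euclidean_space"
  assumes uv: "dist u v = 2"
  shows "real (contact_number n c) * measure lebesgue (cball u r \<inter> cball (v :: 'a) r)
    \<le> (\<Sum>(j, k)\<in>{(j, k). 1 \<le> j \<and> j < k \<and> k \<le> n}. measure lebesgue (cball (c j) r \<inter> cball (c k) r))"
    (is "_ * ?L \<le> sum ?f ?P")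
proof -
  let ?S = "{(j, k). 1 \<le> j \<and> j < k \<and> k \<le> n \<and> norm (c j - c k) = 2}"
  have "real (contact_number n c) * ?L \<le> sum ?f ?S"
    unfolding contact_number_def
  proof (rule sum_bounded_below)
    fix p assume "p \<in> ?S"
    then obtain j k where p: "p = (j, k)" "dist (c j) (c k) = 2" by (auto simp: dist_norm)
    then show "?L \<le> ?f p" unfolding p(1) prod.case by (intro measure_lens_le) (simp add: uv p)
  qed
  also have "\<dots> \<le> sum ?f ?P"
    using finite_index_pairs[of n "\<lambda>_ _. True"] by (intro sum_mono2) auto
  finally show ?thesis .
qed

text \<open>A packing of least volume gives the largest quotient, so the supremum is attained and is
  a true maximum.\<close>

lemma packing_delta_eqI:
  fixes c' :: "nat \<Rightarrow> 'a::euclidean_space"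
  assumes "1 \<le> n" "0 < l" "unit_ball_packing n c'"
    and "\<And>c :: nat \<Rightarrow> 'a. unit_ball_packing n c \<Longrightarrow> thickened_volume n l c' \<le> thickened_volume n l c"
  shows "packing_delta TYPE('a) n l = real n * measure lebesgue (cball (0 :: 'a) 1) / thickened_volume n l c'"
  unfolding packing_delta_def
proof (rule cSup_eq_maximum)
  fix y assume "y \<in> (\<lambda>c :: nat \<Rightarrow> 'a. real n * measure lebesgue (cball (0 :: 'a) 1) / thickened_volume n l c) ` {c. unit_ball_packing n c}"
  then obtain c :: "nat \<Rightarrow> 'a" where "unit_ball_packing n c"
    "y = real n * measure lebesgue (cball (0 :: 'a) 1) / thickened_volume n l c" by blast
  then show "y \<le> real n * measure lebesgue (cball (0 :: 'a) 1) / thickened_volume n l c'"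
    using assms thickened_volume_pos[of n l c'] by (auto intro!: divide_left_mono mult_pos_pos thickened_volume_pos)
qed (use assms in auto)

theorem theorem1:
  fixes n :: nat
  assumes "n > 1" and "DIM('a::euclidean_space) > 1"
  shows "\<exists>l0 > (0::real). \<exists>c' :: nat \<Rightarrow> 'a.
           unit_ball_packing n c' \<and>
           (\<forall>c :: nat \<Rightarrow> 'a. unit_ball_packing n c \<longrightarrow> contact_number n c \<le> contact_number n c') \<and>
           (\<forall>l. 0 < l \<and> l < l0 \<longrightarrow>
              packing_delta TYPE('a) n l
                = real n * measure lebesgue (cball (0 :: 'a) 1) / thickened_volume n l c' \<and>
              (\<forall>c :: nat \<Rightarrow> 'a. unit_ball_packing n c \<longrightarrow>
                 thickened_volume n l c \<ge> thickened_volume n l c'))"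
proof -
  obtain c0 :: "nat \<Rightarrow> 'a" where "unit_ball_packing n c0"
    using unit_ball_packing_exists by blast
  then obtain c' :: "nat \<Rightarrow> 'a" where c': "unit_ball_packing n c'"
    and max: "\<And>c :: nat \<Rightarrow> 'a. unit_ball_packing n c \<Longrightarrow> contact_number n c \<le> contact_number n c'"
    using ex_has_greatest_nat[of "unit_ball_packing n" c0 "contact_number n" "n * n + 1"] contact_number_le
    by (metis less_Suc_eq_le Suc_eq_plus1)
  obtain \<epsilon> where \<epsilon>: "0 < \<epsilon>"
    and card: "\<And>c :: nat \<Rightarrow> 'a. unit_ball_packing n c \<Longrightarrow>
      card {(j, k). 1 \<le> j \<and> j < k \<and> k \<le> n \<and> dist (c j) (c k) \<le> 2 + \<epsilon>} \<le> contact_number n c'"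
    using card_almost_contacts_le[OF max] by blast
  \<comment> \<open>The points 0 and \<open>e\<close> are the centres of the reference touching
    pair.\<close>
  obtain e :: 'a where e: "dist 0 e = 2" using vector_choose_size[of 2] by auto
  \<comment> \<open>The bound 1/10 excludes triple overlaps; \<open>\<epsilon> / 2\<close> gives
    \<open>2 * (1 + l) \<le> 2 + \<epsilon>\<close>, so only almost contacts have nonempty
    lenses.\<close>
  define l0 where "l0 = min (1/10) (\<epsilon> / 2)"
  have vol: "thickened_volume n l c' \<le> thickened_volume n l c"
    if l: "0 < l" "l < l0" and c: "unit_ball_packing n c" for l and c :: "nat \<Rightarrow> 'a"
  proof -
    have "{(j, k). 1 \<le> j \<and> j < k \<and> k \<le> n \<and> dist (c j) (c k) \<le> 2 * (1 + l)}
      \<subseteq> {(j, k). 1 \<le> j \<and> j < k \<and> k \<le> n \<and> dist (c j) (c k) \<le> 2 + \<epsilon>}"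
      using l by (auto simp: l0_def)
    then have "card {(j, k). 1 \<le> j \<and> j < k \<and> k \<le> n \<and> dist (c j) (c k) \<le> 2 * (1 + l)} \<le> contact_number n c'"
      using card[OF c] card_mono[OF finite_index_pairs] by (meson order_trans)
    \<comment> \<open>Both lens sums are compared with \<open>contact_number n c'\<close> reference
      lenses. The volumes differ only through these sums, so the larger sum for \<open>c'\<close>
      means the smaller volume.\<close>
    note sum_lenses_le[OF c e this]
    also note contact_number_lenses_le_sum[OF e, of n c' "1 + l"]
    finally show ?thesis
      using l by (simp add: thickened_volume_eq[OF c] thickened_volume_eq[OF c'] l0_def)
  qed
  show ?thesis
  proof (intro exI[of _ l0] exI[of _ c'] conjI allI impI c' max)
    show "0 < l0" using \<epsilon> by (simp add: l0_def)
  next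
    fix l assume "0 < l \<and> l < l0"
    then show "packing_delta TYPE('a) n l = real n * measure lebesgue (cball (0 :: 'a) 1) / thickened_volume n l c'"
      using assms(1) c' vol by (intro packing_delta_eqI) auto
  qed (use vol in auto)
qed

end
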